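(* Let $G$ be an infinite group and let $m,n$ be cardinals. There exists a $G$-regular $1$-factorization of the complete equipartite graph $K_m[n]$ if and only if $G$ has a subgroup $H$ with $|H|=n$ whose index in $G$ is $m$.
   Context: All graphs are simple without loops. $K_m[n]$ denotes the complete equipartite graph on $mn$ vertices partitioned into $m$ parts of size $n$, two vertices being adjacent iff they lie in distinct parts. A $1$-factor of a graph $\Lambda$ is a spanning subgraph in which every vertex has degree exactly $1$; a $1$-factorization of $\Lambda$ is a set of $1$-factors of $\Lambda$ whose edge sets partition $E(\Lambda)$. An automorphism of a $1$-factorization $\mathcal{G}$ is a bijection $\beta$ of $V(\Lambda)$ such that $\beta(\Gamma)\in\mathcal{G}$ for every $\Gamma\in\mathcal{G}$. $\mathcal{G}$ is $G$-regular if it has an automorphism group isomorphic to $G$ acting sharply transitively on $V(\Lambda)$. *)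

theory Defs
  imports "HOL-Algebra.Bij" "HOL-Algebra.Coset" "HOL-Library.Disjoint_Sets"
begin

unbundle cardinal_syntax

datatype 'v graph = Graph (verts: "'v set") (edges: "'v set set")

definition simple_graph :: "'v graph \<Rightarrow> bool" where
  "simple_graph \<Gamma> \<longleftrightarrow> (\<forall>e \<in> edges \<Gamma>. e \<subseteq> verts \<Gamma> \<and> card e = 2)"

definition spanning_subgraph :: "'v graph \<Rightarrow> 'v graph \<Rightarrow> bool" where
  "spanning_subgraph \<Gamma> \<Lambda> \<longleftrightarrow>
     simple_graph \<Gamma> \<and> verts \<Gamma> = verts \<Lambda> \<and> edges \<Gamma> \<subseteq> edges \<Lambda>"

text \<open>The value is 0 at a vertex of infinite degree; below, degrees are only compared with 1.\<close>

definition degree :: "'v graph \<Rightarrow> 'v \<Rightarrow> nat" where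
  "degree \<Gamma> v = card {e \<in> edges \<Gamma>. v \<in> e}"

definition one_factor :: "'v graph \<Rightarrow> 'v graph \<Rightarrow> bool" where
  "one_factor \<Lambda> \<Gamma> \<longleftrightarrow> spanning_subgraph \<Gamma> \<Lambda> \<and> (\<forall>v \<in> verts \<Gamma>. degree \<Gamma> v = 1)"

text \<open>Distinct 1-factors of \<open>\<Lambda>\<close> have distinct edge sets, as they share the vertex set of \<open>\<Lambda>\<close>;
  so nothing is lost by partitioning into the \<^emph>\<open>set\<close> of edge sets.\<close>

definition one_factorization :: "'v graph \<Rightarrow> 'v graph set \<Rightarrow> bool" where
  "one_factorization \<Lambda> \<G> \<longleftrightarrow>
     (\<forall>\<Gamma> \<in> \<G>. one_factor \<Lambda> \<Gamma>) \<and> partition_on (edges \<Lambda>) (edges ` \<G>)"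

definition image_graph :: "('v \<Rightarrow> 'w) \<Rightarrow> 'v graph \<Rightarrow> 'w graph" where
  "image_graph \<beta> \<Gamma> = Graph (\<beta> ` verts \<Gamma>) ((\<lambda>e. \<beta> ` e) ` edges \<Gamma>)"

text \<open>The condition is the inclusion of \<open>\<beta>(\<G>)\<close> in \<open>\<G>\<close>, so for infinite \<open>\<G>\<close> this set need not be
  closed under inverses. An automorphism group is therefore taken to be a subgroup of the
  symmetric group on the vertex set that consists of automorphisms.\<close>

definition automorphisms :: "'v graph \<Rightarrow> 'v graph set \<Rightarrow> ('v \<Rightarrow> 'v) set" where
  "automorphisms \<Lambda> \<G> = {\<beta> \<in> Bij (verts \<Lambda>). \<forall>\<Gamma> \<in> \<G>. image_graph \<beta> \<Gamma> \<in> \<G>}"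

definition automorphism_group :: "'v graph \<Rightarrow> 'v graph set \<Rightarrow> ('v \<Rightarrow> 'v) set \<Rightarrow> bool" where
  "automorphism_group \<Lambda> \<G> A \<longleftrightarrow> subgroup A (BijGroup (verts \<Lambda>)) \<and> A \<subseteq> automorphisms \<Lambda> \<G>"

definition sharply_transitive :: "('v \<Rightarrow> 'v) set \<Rightarrow> 'v set \<Rightarrow> bool" where
  "sharply_transitive A V \<longleftrightarrow> (\<forall>x \<in> V. \<forall>y \<in> V. \<exists>!\<beta>. \<beta> \<in> A \<and> \<beta> x = y)"

definition regular_one_factorization ::
    "('a, 'b) monoid_scheme \<Rightarrow> 'v graph \<Rightarrow> 'v graph set \<Rightarrow> bool" where
  "regular_one_factorization G \<Lambda> \<G> \<longleftrightarrow>
     one_factorization \<Lambda> \<G> \<and>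
     (\<exists>A. automorphism_group \<Lambda> \<G> A \<and>
          G \<cong> (BijGroup (verts \<Lambda>))\<lparr>carrier := A\<rparr> \<and>
          sharply_transitive A (verts \<Lambda>))"

text \<open>Cardinals are cardinal orders, a cardinal \<open>m\<close> having the canonical set \<open>Field m\<close> of that
  cardinality. The parts of \<open>K\<^sub>m[n]\<close> are the sets \<open>{i} \<times> Field n\<close> for \<open>i \<in> Field m\<close>.\<close>

definition complete_equipartite :: "'m rel \<Rightarrow> 'n rel \<Rightarrow> ('m \<times> 'n) graph" where
  "complete_equipartite m n =
     Graph (Field m \<times> Field n)
       {{x, y} | x y. x \<in> Field m \<times> Field n \<and> y \<in> Field m \<times> Field n \<and> fst x \<noteq> fst y}"

end

theory Submission
  imports Defs
begin

text \<open>Given a regular \<open>1\<close>-factorization, the subgroup \<open>H\<close> is the stabilizer of a part. Conversely,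
  \<open>K\<^sub>m[n]\<close> is the Cayley graph on \<open>G\<close> in which \<open>x\<close> and \<open>y\<close> are adjacent iff the difference \<open>x y\<inverse>\<close>
  is not in \<open>H\<close>; \<open>G\<close> acts by right translation, which preserves differences. The edges whose
  difference is a given involution form a translation-invariant \<open>1\<close>-factor. Let \<open>N\<close> be the set of
  non-involutions outside \<open>H\<close>. A \<open>1\<close>-factor whose edges realize each difference in \<open>N\<close> exactly once
  has translates that partition the remaining edges. As \<open>N\<close> is either empty or of the same
  cardinality as \<open>G\<close>, such a factor can be built by transfinite recursion: at every stage fewer
  than \<open>|G|\<close> vertices and differences have been used, so the next vertex and the next difference
  can be covered by new edges.\<close>

section \<open>Cardinality estimates for small sets and images\<close>

text \<open>Bounds the number of edges chosen before a given stage of the transfinite recursion. A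
  union of finite sets over an infinite index set is no larger than the index set; over a finite one
  it is finite.\<close>

lemma card_of_UNION_finite_ordLess:
  assumes "infinite C" "|I| <o |C|" "\<And>i. i \<in> I \<Longrightarrow> finite (A i)"
  shows "|\<Union>i\<in>I. A i| <o |C|"
proof (cases "finite I")
  case True
  then have "finite (\<Union>i\<in>I. A i)" using assms(3) by blast
  then show ?thesis
    using assms(1) finite_ordLess_infinite[OF card_of_Well_order card_of_Well_order]
    by (metis Field_card_of)
next
  case False
  have "|\<Union>i\<in>I. A i| \<le>o |I|"
  proof (rule card_of_UNION_ordLeq_infinite[OF False card_of_mono1])
    show "\<forall>i\<in>I. |A i| \<le>o |I|"
      using assms(3) False finite_ordLess_infinite[OF card_of_Well_order card_of_Well_order]
      by (metis Field_card_of ordLess_imp_ordLeq)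
  qed auto
  then show ?thesis using assms(2) ordLeq_ordLess_trans by blast
qed

lemma card_of_image_ordLess: "|A| <o r \<Longrightarrow> |f ` A| <o r"
  using card_of_image ordLeq_ordLess_trans by blast

lemma card_of_subset_ordLess: "A \<subseteq> B \<Longrightarrow> |B| <o r \<Longrightarrow> |A| <o r"
  using card_of_mono1 ordLeq_ordLess_trans by blast

lemma card_of_ordLess_obtains:
  assumes "|A| <o |B|"
  obtains x where "x \<in> B" "x \<notin> A"
proof -
  have "\<not> B \<subseteq> A" using assms card_of_mono1 not_ordLess_ordLeq by blast
  then show ?thesis using that by blast
qed

text \<open>Maps with the same fibres on \<open>A\<close> induce a bijection between their images.
  This serves to count right cosets by the parts of the graph.\<close>

lemma card_of_image_cong:
  assumes "\<And>x y. x \<in> A \<Longrightarrow> y \<in> A \<Longrightarrow> f x = f y \<longleftrightarrow> g x = g y"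
  shows "|f ` A| =o |g ` A|"
proof -
  let ?h = "\<lambda>z. g (inv_into A f z)"
  have h: "?h (f x) = g x" if "x \<in> A" for x
    using assms[of "inv_into A f (f x)" x] that
    by (simp add: f_inv_into_f inv_into_into)
  have "bij_betw ?h (f ` A) (g ` A)"
    unfolding bij_betw_def
  proof
    show "inj_on ?h (f ` A)" using h assms by (auto simp: inj_on_def)
    show "?h ` f ` A = g ` A" using h by (force simp: image_iff)
  qed
  then show ?thesis by (rule card_of_ordIsoI)
qed

section \<open>Subgroups with small complement and the number of non-involutions\<close>

context group begin

lemma inv_commutes:
  assumes "a \<in> carrier G" "b \<in> carrier G" "a \<otimes> b = b \<otimes> a"
  shows "inv a \<otimes> b = b \<otimes> inv a"
proof -
  have "inv a \<otimes> b = inv a \<otimes> (b \<otimes> a) \<otimes> inv a"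
    using assms(1,2) by (simp add: m_assoc)
  also have "\<dots> = inv a \<otimes> (a \<otimes> b) \<otimes> inv a" using assms(3) by simp
  also have "\<dots> = b \<otimes> inv a" using assms(1,2) by (simp add: m_assoc[symmetric])
  finally show ?thesis .
qed

lemma mult_commutes:
  assumes "a \<in> carrier G" "b \<in> carrier G" "c \<in> carrier G" "a \<otimes> c = c \<otimes> a" "b \<otimes> c = c \<otimes> b"
  shows "(a \<otimes> b) \<otimes> c = c \<otimes> (a \<otimes> b)"
  using assms m_assoc by metis

text \<open>For \<open>x\<close> in \<open>H - S\<close> the coset of \<open>S\<close> through
  \<open>x\<close> lies in \<open>H - S\<close>, so \<open>S\<close> would be no larger than its
  complement, and the infinite set \<open>H\<close> would be a union of two strictly smaller
  sets.\<close>

lemma subgroup_eqI_small_complement: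
  assumes S: "subgroup S G" and H: "subgroup H G" and "S \<subseteq> H" "infinite H" "|H - S| <o |H|"
  shows "S = H"
proof (rule ccontr)
  assume "S \<noteq> H"
  then obtain x where x: "x \<in> H" "x \<notin> S" using assms(3) by blast
  note SG = subgroup.mem_carrier[OF S] and HG = subgroup.mem_carrier[OF H]
  have "s \<otimes> x \<in> H - S" if "s \<in> S" for s
  proof -
    have "s \<otimes> x \<notin> S"
    proof
      assume "s \<otimes> x \<in> S"
      then have "inv s \<otimes> (s \<otimes> x) \<in> S" using S that by (simp add: subgroup.m_closed subgroup.m_inv_closed)
      then show False using x SG HG that by (simp add: m_assoc[symmetric])
    qed
    then show ?thesis using that x assms(3) subgroup.m_closed[OF H] by blast
  qed
  moreover have "inj_on (\<lambda>s. s \<otimes> x) S"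
    using SG HG x by (auto simp: inj_on_def)
  ultimately have "|S| \<le>o |H - S|" by (intro card_of_ordLeqI[where f = "\<lambda>s. s \<otimes> x"])
  then have "|S| <o |H|" using assms(5) ordLeq_ordLess_trans by blast
  then have "|S \<union> (H - S)| <o |H|" using assms card_of_Un_ordLess_infinite by blast
  moreover have "S \<union> (H - S) = H" using assms(3) by blast
  ultimately show False using ordLess_irreflexive by auto
qed

text \<open>A homomorphism inverting \<open>h\<close>, \<open>k\<close> and \<open>h k\<close> makes \<open>h\<close> and \<open>k\<close> commute. So the elements
  inverted by \<open>f\<close> have large centralizers and are central; hence \<open>H\<close> is abelian, and the elements
  inverted by \<open>f\<close> form a subgroup.\<close>

lemma hom_eq_inv_on_subgroup:
  assumes H: "subgroup H G" "infinite H" and f: "f \<in> hom G G"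
    and small: "|{h \<in> H. f h \<noteq> inv h}| <o |H|"
  shows "\<forall>h\<in>H. f h = inv h"
proof -
  define B where "B = {h \<in> H. f h \<noteq> inv h}"
  note HG = subgroup.mem_carrier[OF H(1)] and Hm = subgroup.m_closed[OF H(1)]
    and Hi = subgroup.m_inv_closed[OF H(1)]
  have B: "|B| <o |H|" using small B_def by simp
  have comm: "h \<otimes> k = k \<otimes> h" if h: "h \<in> H - B" and k: "k \<in> H - B" "h \<otimes> k \<notin> B" for h k
  proof -
    have "inv (h \<otimes> k) = inv h \<otimes> inv k"
      using that HG Hm hom_mult[OF f, of h k] by (auto simp: B_def)
    then have "inv (h \<otimes> k) = inv (k \<otimes> h)" using h k HG by (simp add: inv_mult_group)
    then show ?thesis using h k HG by (metis DiffD1 inv_inv m_closed)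
  qed
  have cent: "\<forall>k\<in>H. h \<otimes> k = k \<otimes> h" if h: "h \<in> H - B" for h
  proof -
    let ?C = "{k \<in> H. h \<otimes> k = k \<otimes> h}"
    have hG: "h \<in> carrier G" using h HG by blast
    have "subgroup ?C G"
    proof (rule subgroupI)
      show "?C \<subseteq> carrier G" using HG by blast
      show "?C \<noteq> {}" using hG subgroup.one_closed[OF H(1)] by auto
      show "inv a \<in> ?C" if "a \<in> ?C" for a
        using that hG HG Hi inv_commutes[of a h] by auto
      show "a \<otimes> b \<in> ?C" if "a \<in> ?C" "b \<in> ?C" for a b
        using that hG HG Hm mult_commutes[of a b h] by auto
    qed
    moreover have "|H - ?C| <o |H|"
    proof (rule card_of_subset_ordLess)
      \<comment> \<open>If neither \<open>k\<close> nor \<open>h \<otimes> k\<close> lies in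
        \<open>B\<close>, then \<open>comm\<close> applies. So a \<open>k\<close> outside the
        centralizer lies in \<open>B\<close> or in the translate of \<open>B\<close> by
        \<open>inv h\<close>.\<close>
      show "H - ?C \<subseteq> B \<union> (\<lambda>b. inv h \<otimes> b) ` B"
      proof
        fix k assume k: "k \<in> H - ?C"
        then have "k \<in> B \<or> h \<otimes> k \<in> B" using comm h by blast
        moreover have "k = inv h \<otimes> (h \<otimes> k)" using k hG HG by (simp add: m_assoc[symmetric])
        ultimately show "k \<in> B \<union> (\<lambda>b. inv h \<otimes> b) ` B" by blast
      qed
      show "|B \<union> (\<lambda>b. inv h \<otimes> b) ` B| <o |H|"
        using B H(2) by (intro card_of_Un_ordLess_infinite card_of_image_ordLess)
    qed
    ultimately have "?C = H" using H by (intro subgroup_eqI_small_complement) auto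
    then show ?thesis by blast
  qed
  have abelian: "\<forall>h\<in>H. \<forall>k\<in>H. h \<otimes> k = k \<otimes> h"
  proof -
    let ?Z = "{h \<in> H. \<forall>k\<in>H. h \<otimes> k = k \<otimes> h}"
    have "subgroup ?Z G"
    proof (rule subgroupI)
      show "?Z \<subseteq> carrier G" using HG by blast
      show "?Z \<noteq> {}" using HG subgroup.one_closed[OF H(1)] by auto
      show "inv a \<in> ?Z" if "a \<in> ?Z" for a
        using that HG Hi inv_commutes[of a] by blast
      show "a \<otimes> b \<in> ?Z" if "a \<in> ?Z" "b \<in> ?Z" for a b
        using that HG Hm mult_commutes[of a b] by blast
    qed
    moreover have "|H - ?Z| <o |H|"
      using cent by (intro card_of_subset_ordLess[OF _ B]) blast
    ultimately have "?Z = H" using H by (intro subgroup_eqI_small_complement) auto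
    then show ?thesis by blast
  qed
  let ?K = "{h \<in> H. f h = inv h}"
  interpret f: group_hom G G f using f by unfold_locales
  have "subgroup ?K G"
  proof (rule subgroupI)
    show "?K \<subseteq> carrier G" using HG by blast
    show "?K \<noteq> {}" using subgroup.one_closed[OF H(1)] by auto
    show "inv a \<in> ?K" if "a \<in> ?K" for a
      using that HG Hi by auto
    show "a \<otimes> b \<in> ?K" if "a \<in> ?K" "b \<in> ?K" for a b
      using that HG Hm Hi abelian by (auto simp: inv_mult_group)
  qed
  moreover have "H - ?K = B" by (auto simp: B_def)
  ultimately have "?K = H" using H B by (intro subgroup_eqI_small_complement) auto
  then show ?thesis by blast
qed

text \<open>If \<open>N\<close> is small and \<open>H\<close> is large, some coset \<open>t H\<close> with \<open>t\<^sup>2 = 1\<close> consists almost entirely of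
  involutions, which means that conjugation by \<open>t\<close> inverts almost all of \<open>H\<close>. If \<open>H\<close> is small,
  almost all of \<open>G\<close> is inverted by the identity map.\<close>

lemma noninvolutions_outside_subgroup:
  assumes H: "subgroup H G" and inf: "infinite (carrier G)"
    and N: "N = {d \<in> carrier G - H. d \<otimes> d \<noteq> \<one>}"
  shows "N = {} \<or> |N| =o |carrier G|"
proof (rule disjCI)
  assume "\<not> |N| =o |carrier G|"
  moreover have "|N| \<le>o |carrier G|" using N by (intro card_of_mono1) blast
  ultimately have N_less: "|N| <o |carrier G|"
    using ordLeq_iff_ordLess_or_ordIso by blast
  note HG = subgroup.mem_carrier[OF H] and Hm = subgroup.m_closed[OF H]
    and Hi = subgroup.m_inv_closed[OF H]
  have inv_iff: "inv d = d \<longleftrightarrow> d \<otimes> d = \<one>" if "d \<in> carrier G" for d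
    using that inv_equality r_inv by metis
  show "N = {}"
  proof (rule ccontr)
    assume "N \<noteq> {}"
    then obtain x where x: "x \<in> N" by blast
    then have xG: "x \<in> carrier G" and xH: "x \<notin> H" and xx: "x \<otimes> x \<noteq> \<one>" using N by auto
    consider "|H| <o |carrier G|" | "|H| =o |carrier G|"
      using card_of_mono1[OF subgroup.subset[OF H]] ordLeq_iff_ordLess_or_ordIso by blast
    then show False
    proof cases
      case 1
      have "|{h \<in> carrier G. id h \<noteq> inv h}| <o |carrier G|"
      proof (rule card_of_subset_ordLess)
        show "{h \<in> carrier G. id h \<noteq> inv h} \<subseteq> N \<union> H" using N inv_iff by fastforce
        show "|N \<union> H| <o |carrier G|" using inf N_less 1 by (rule card_of_Un_ordLess_infinite)
      qed
      then have "\<forall>h\<in>carrier G. id h = inv h"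
        using subgroup_self inf by (intro hom_eq_inv_on_subgroup) (auto simp: hom_def)
      then show False using xG xx inv_iff by (metis id_apply)
    next
      case 2
      have infH: "infinite H" using 2 inf card_of_ordIso_finite by blast
      have N_H: "|N| <o |H|" using N_less 2 ordIso_symmetric ordLess_ordIso_trans by blast
      \<comment> \<open>Fewer than \<open>|H|\<close> elements \<open>h\<close> put
        \<open>x \<otimes> h\<close> into \<open>N\<close>, and \<open>h0\<close> avoids them. Then
        \<open>t\<close> lies outside both \<open>H\<close> and \<open>N\<close>, so it squares to
        \<open>\<one>\<close>.\<close>
      obtain h0 where h0: "h0 \<in> H" "h0 \<notin> (\<lambda>d. inv x \<otimes> d) ` N"
        using card_of_ordLess_obtains[OF card_of_image_ordLess[OF N_H]] by metis
      define t where "t = x \<otimes> h0"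
      have tG: "t \<in> carrier G" using xG h0 HG t_def by simp
      have coset: "t \<otimes> h \<in> carrier G - H" if h: "h \<in> H" for h
      proof -
        have "t \<otimes> h \<notin> H"
        proof
          assume "t \<otimes> h \<in> H"
          then have "t \<otimes> h \<otimes> inv (h0 \<otimes> h) \<in> H" using Hm Hi h h0 by blast
          moreover have "t \<otimes> h \<otimes> inv (h0 \<otimes> h) = x"
            using xG HG h h0 by (simp add: t_def m_assoc inv_solve_right')
          ultimately show False using xH by simp
        qed
        then show ?thesis using tG HG h by simp
      qed
      have "t \<notin> N"
      proof
        assume "t \<in> N"
        moreover have "h0 = inv x \<otimes> t" using xG HG h0 by (simp add: t_def m_assoc[symmetric])
        ultimately show False using h0 by blast
      qed
      then have tt: "t \<otimes> t = \<one>" using coset[of \<one>] subgroup.one_closed[OF H] tG N by simp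
      have tht: "t \<otimes> h \<otimes> t = inv h \<longleftrightarrow> (t \<otimes> h) \<otimes> (t \<otimes> h) = \<one>" if "h \<in> carrier G" for h
        using that tG by (metis inv_equality l_inv m_assoc m_closed)
      have "|{h \<in> H. t \<otimes> h \<otimes> t \<noteq> inv h}| <o |H|"
      proof (rule card_of_subset_ordLess)
        show "{h \<in> H. t \<otimes> h \<otimes> t \<noteq> inv h} \<subseteq> (\<lambda>d. inv t \<otimes> d) ` N"
        proof
          fix h assume h: "h \<in> {h \<in> H. t \<otimes> h \<otimes> t \<noteq> inv h}"
          then have "t \<otimes> h \<in> N" using tht N coset HG by blast
          moreover have "h = inv t \<otimes> (t \<otimes> h)" using tG h HG by (simp add: m_assoc[symmetric])
          ultimately show "h \<in> (\<lambda>d. inv t \<otimes> d) ` N" by blast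
        qed
        show "|(\<lambda>d. inv t \<otimes> d) ` N| <o |H|" using N_H by (rule card_of_image_ordLess)
      qed
      moreover have "(\<lambda>h. t \<otimes> h \<otimes> t) \<in> hom G G"
      proof (rule homI)
        fix a b assume ab: "a \<in> carrier G" "b \<in> carrier G"
        have "t \<otimes> a \<otimes> t \<otimes> (t \<otimes> b \<otimes> t) = t \<otimes> a \<otimes> (t \<otimes> t) \<otimes> b \<otimes> t"
          using ab tG by (simp add: m_assoc)
        then show "t \<otimes> (a \<otimes> b) \<otimes> t = t \<otimes> a \<otimes> t \<otimes> (t \<otimes> b \<otimes> t)"
          using ab tG tt by (simp add: m_assoc)
      qed (use tG in simp)
      ultimately have "\<forall>h\<in>H. t \<otimes> h \<otimes> t = inv h"
        using hom_eq_inv_on_subgroup[OF H infH] by blast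
      \<comment> \<open>The choice \<open>h = inv h0\<close> recovers \<open>x\<close> as
        \<open>t \<otimes> h\<close>, so \<open>x\<close> would square to
        \<open>\<one>\<close>.\<close>
      then have "(t \<otimes> inv h0) \<otimes> (t \<otimes> inv h0) = \<one>" using tht h0 Hi HG by blast
      moreover have "t \<otimes> inv h0 = x" using xG HG h0 by (simp add: t_def m_assoc)
      ultimately show False using xx by simp
    qed
  qed
qed

section \<open>Starters and their construction by transfinite recursion\<close>

text \<open>A starter is stored as the symmetric relation joining the two ends of its edges. Each edge
  \<open>{x, y}\<close> then carries both differences \<open>x y\<inverse>\<close> and \<open>y x\<inverse>\<close>, which are distinct for
  non-involutions, so that injectivity of the difference map counts every difference once.\<close>

definition partial_starter :: "'a set \<Rightarrow> 'a rel \<Rightarrow> bool" where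
  "partial_starter N M \<longleftrightarrow> M \<subseteq> carrier G \<times> carrier G \<and> sym M \<and> single_valued M \<and>
     inj_on (\<lambda>(x, y). x \<otimes> inv y) M \<and> (\<lambda>(x, y). x \<otimes> inv y) ` M \<subseteq> N"

text \<open>As \<open>M\<close> is symmetric, its differences are closed under inverses, so the
  reversed pair brings a new difference as soon as \<open>(x, y)\<close> does. The two new
  differences are distinct because no element of \<open>N\<close> is its own inverse; this also
  keeps \<open>\<one>\<close> out of \<open>N\<close>, whence \<open>x \<noteq> y\<close>.\<close>

lemma partial_starter_insert:
  assumes M: "partial_starter N M" and N: "\<And>d. d \<in> N \<Longrightarrow> inv d \<in> N \<and> inv d \<noteq> d"
    and xy: "x \<in> carrier G" "y \<in> carrier G" "x \<notin> Domain M" "y \<notin> Domain M"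
    and d: "x \<otimes> inv y \<in> N" "x \<otimes> inv y \<notin> (\<lambda>(x, y). x \<otimes> inv y) ` M"
  shows "partial_starter N (M \<union> {(x, y), (y, x)})"
proof -
  have inv_d: "y \<otimes> inv x = inv (x \<otimes> inv y)" using xy by (simp add: inv_mult_group)
  have "x \<noteq> y" using d(1) N[of \<one>] xy by auto
  have sym: "(b, a) \<in> M" if "(a, b) \<in> M" for a b
    using M that by (auto simp: partial_starter_def dest: symD)
  have MG: "a \<in> carrier G \<and> b \<in> carrier G" if "(a, b) \<in> M" for a b
    using M that by (auto simp: partial_starter_def)
  have nd: "x \<otimes> inv y \<noteq> a \<otimes> inv b" if "(a, b) \<in> M" for a b
    using d(2) that by force
  have nd': "y \<otimes> inv x \<noteq> a \<otimes> inv b" if "(a, b) \<in> M" for a b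
  proof
    assume "y \<otimes> inv x = a \<otimes> inv b"
    then have "inv (inv (x \<otimes> inv y)) = inv (a \<otimes> inv b)" using inv_d by simp
    then have "x \<otimes> inv y = b \<otimes> inv a" using MG[OF that] xy by (simp add: inv_mult_group)
    then show False using nd[OF sym[OF that]] by blast
  qed
  have ne: "x \<otimes> inv y \<noteq> y \<otimes> inv x" using inv_d N[OF d(1)] by metis
  show ?thesis
    unfolding partial_starter_def
  proof (intro conjI)
    show "M \<union> {(x, y), (y, x)} \<subseteq> carrier G \<times> carrier G"
      using M xy by (auto simp: partial_starter_def)
    show "sym (M \<union> {(x, y), (y, x)})"
      using sym by (auto simp: sym_def)
    show "single_valued (M \<union> {(x, y), (y, x)})"
      using M xy \<open>x \<noteq> y\<close> by (auto simp: partial_starter_def single_valued_def)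
    let ?\<delta> = "\<lambda>(x, y). x \<otimes> inv y"
    have "inj_on ?\<delta> M" using M by (simp add: partial_starter_def)
    moreover have "?\<delta> (y, x) \<notin> ?\<delta> ` M" using nd' by fastforce
    ultimately have "inj_on ?\<delta> (insert (y, x) M)"
      unfolding inj_on_insert by (metis Diff_subset image_mono subsetD)
    moreover have "?\<delta> (x, y) \<notin> ?\<delta> ` insert (y, x) M" using d(2) ne by simp
    ultimately have "inj_on ?\<delta> (insert (x, y) (insert (y, x) M))"
      unfolding inj_on_insert[of _ "(x, y)"] by (metis Diff_subset image_mono subsetD)
    then show "inj_on ?\<delta> (M \<union> {(x, y), (y, x)})" by simp
    show "(\<lambda>(x, y). x \<otimes> inv y) ` (M \<union> {(x, y), (y, x)}) \<subseteq> N"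
      using M d(1) N inv_d by (auto simp: partial_starter_def)
  qed
qed

text \<open>Every defining condition concerns at most two pairs, and two pairs in the union of a
  chain already lie in a common member.\<close>

lemma partial_starter_Union:
  assumes "\<And>M. M \<in> C \<Longrightarrow> partial_starter N M" "chain\<^sub>\<subseteq> C"
  shows "partial_starter N (\<Union>C)"
proof -
  have common: "\<exists>M\<in>C. p \<in> M \<and> q \<in> M" if "p \<in> \<Union>C" "q \<in> \<Union>C" for p q
    using that assms(2) unfolding chain_subset_def by blast
  show ?thesis
    unfolding partial_starter_def
  proof (intro conjI)
    show "\<Union>C \<subseteq> carrier G \<times> carrier G" using assms(1) by (auto simp: partial_starter_def)
    show "sym (\<Union>C)" using assms(1) by (force simp: partial_starter_def sym_def)
    show "single_valued (\<Union>C)"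
    proof (rule single_valuedI)
      fix x y z assume "(x, y) \<in> \<Union>C" "(x, z) \<in> \<Union>C"
      then obtain M where "M \<in> C" "(x, y) \<in> M" "(x, z) \<in> M" using common by blast
      then show "y = z" using assms(1) by (auto simp: partial_starter_def dest: single_valuedD)
    qed
    show "inj_on (\<lambda>(x, y). x \<otimes> inv y) (\<Union>C)"
    proof (rule inj_onI)
      fix p q assume pq: "p \<in> \<Union>C" "q \<in> \<Union>C" "(case p of (x, y) \<Rightarrow> x \<otimes> inv y) = (case q of (x, y) \<Rightarrow> x \<otimes> inv y)"
      then obtain M where "M \<in> C" "p \<in> M" "q \<in> M" using common by blast
      then show "p = q" using assms(1) pq(3) unfolding partial_starter_def
        by (metis (no_types, lifting) inj_onD)
    qed
    show "(\<lambda>(x, y). x \<otimes> inv y) ` \<Union>C \<subseteq> N" using assms(1) by (fastforce simp: partial_starter_def)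
  qed
qed

text \<open>The element \<open>i\<close> is treated first as a vertex to be covered and then, if it
  lies in \<open>N\<close>, as a difference to be realized. Each task is already done or takes one
  new edge; fewer than \<open>|carrier G|\<close> choices are forbidden, while there are
  \<open>|carrier G|\<close> candidates.\<close>

lemma partial_starter_extend:
  assumes M: "partial_starter N M" and N: "\<And>d. d \<in> N \<Longrightarrow> inv d \<in> N \<and> inv d \<noteq> d"
    and NG: "N \<subseteq> carrier G" and inf: "infinite (carrier G)" and card_N: "|N| =o |carrier G|"
    and small: "|M| <o |carrier G|" and i: "i \<in> carrier G"
  shows "\<exists>E. finite E \<and> partial_starter N (M \<union> E) \<and> i \<in> Domain (M \<union> E) \<and>
           (i \<in> N \<longrightarrow> i \<in> (\<lambda>(x, y). x \<otimes> inv y) ` (M \<union> E))"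
proof -
  have vertex: "\<exists>E. finite E \<and> partial_starter N (M \<union> E) \<and> i \<in> Domain (M \<union> E)"
  proof (cases "i \<in> Domain M")
    case True
    then show ?thesis using M by (intro exI[of _ "{}"]) auto
  next
    case False
    have infN: "infinite N" using card_N inf card_of_ordIso_finite by blast
    have "|M| <o |N|" using small card_N ordIso_symmetric ordLess_ordIso_trans by blast
    \<comment> \<open>The difference \<open>d\<close> determines the other end
      \<open>inv d \<otimes> i\<close> of the edge at \<open>i\<close>. The first set forbids the
      differences already used, the second those for which that end is already covered.\<close>
    then have "|(\<lambda>(x, y). x \<otimes> inv y) ` M \<union> (\<lambda>y. i \<otimes> inv y) ` fst ` M| <o |N|"
      by (intro card_of_Un_ordLess_infinite[OF infN] card_of_image_ordLess)
    then obtain d where d: "d \<in> N" "d \<notin> (\<lambda>(x, y). x \<otimes> inv y) ` M"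
      "d \<notin> (\<lambda>y. i \<otimes> inv y) ` fst ` M"
      using card_of_ordLess_obtains by (metis UnI1 UnI2)
    define y where "y = inv d \<otimes> i"
    have dG: "d \<in> carrier G" using d NG by blast
    have yG: "y \<in> carrier G" using dG i y_def by simp
    have iy: "i \<otimes> inv y = d"
      using i dG by (simp add: y_def inv_mult_group m_assoc[symmetric])
    have "y \<notin> Domain M"
    proof
      assume "y \<in> Domain M"
      then have "d \<in> (\<lambda>y. i \<otimes> inv y) ` fst ` M" using iy by (metis Domain_fst imageI)
      then show False using d by blast
    qed
    then have "partial_starter N (M \<union> {(i, y), (y, i)})"
      using partial_starter_insert[OF M N i yG False] iy d by simp
    then show ?thesis by (intro exI[of _ "{(i, y), (y, i)}"]) auto
  qed
  then obtain E where E: "finite E" "partial_starter N (M \<union> E)" "i \<in> Domain (M \<union> E)" by blast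
  show ?thesis
  proof (cases "i \<in> N \<and> i \<notin> (\<lambda>(x, y). x \<otimes> inv y) ` (M \<union> E)")
    case False
    then show ?thesis using E by blast
  next
    case True
    let ?M = "M \<union> E"
    have "|E| <o |carrier G|"
      using E(1) inf finite_ordLess_infinite[OF card_of_Well_order card_of_Well_order]
      by (metis Field_card_of)
    then have "|?M| <o |carrier G|" using inf small by (intro card_of_Un_ordLess_infinite)
    \<comment> \<open>The edge from \<open>g\<close> to \<open>inv i \<otimes> g\<close> has
      difference \<open>i\<close>. The two excluded sets keep \<open>g\<close> and
      \<open>inv i \<otimes> g\<close>, respectively, away from the covered vertices.\<close>
    then have "|fst ` ?M \<union> (\<lambda>y. i \<otimes> y) ` fst ` ?M| <o |carrier G|"
      by (intro card_of_Un_ordLess_infinite[OF inf, of "fst ` ?M"] card_of_image_ordLess)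
    then obtain g where g: "g \<in> carrier G" "g \<notin> Domain ?M" "g \<notin> (\<lambda>y. i \<otimes> y) ` Domain ?M"
      unfolding Domain_fst using card_of_ordLess_obtains by (metis UnI1 UnI2)
    define y where "y = inv i \<otimes> g"
    have yG: "y \<in> carrier G" and gy: "g = i \<otimes> y" and gd: "g \<otimes> inv y = i"
      using i g by (simp_all add: y_def inv_mult_group m_assoc[symmetric])
    have "y \<notin> Domain ?M" using g(3) gy by blast
    then have "partial_starter N (?M \<union> {(g, y), (y, g)})"
      using partial_starter_insert[OF E(2) N g(1) yG g(2)] gd True by simp
    then have "partial_starter N (M \<union> (E \<union> {(g, y), (y, g)}))" by (simp add: Un_assoc)
    moreover have "i \<in> (\<lambda>(x, y). x \<otimes> inv y) ` (M \<union> (E \<union> {(g, y), (y, g)}))"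
      using gd by force
    ultimately show ?thesis using E(1,3)
      by (intro exI[of _ "E \<union> {(g, y), (y, g)}"]) auto
  qed
qed

text \<open>Every element of \<open>G\<close> occurs as an index of the recursion, so in the union
  of all stages each vertex is covered and each difference in \<open>N\<close> is realized. The map
  \<open>\<phi>\<close> sends a vertex to the other end of its edge.\<close>

lemma exists_starter:
  assumes N: "\<And>d. d \<in> N \<Longrightarrow> inv d \<in> N \<and> inv d \<noteq> d"
    and NG: "N \<subseteq> carrier G" and inf: "infinite (carrier G)" and card_N: "|N| =o |carrier G|"
  obtains \<phi> where "\<And>x. x \<in> carrier G \<Longrightarrow> \<phi> x \<in> carrier G \<and> \<phi> (\<phi> x) = x"
    "bij_betw (\<lambda>x. x \<otimes> inv \<phi> x) (carrier G) N"
proof -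
  let ?r = "|carrier G|" and ?\<delta> = "\<lambda>(x, y). x \<otimes> inv y"
  have wo: "Well_order ?r" by (rule card_of_Well_order)
  then interpret r: wo_rel ?r by (simp add: wo_rel_def)
  have Fr: "Field ?r = carrier G" by (rule Field_card_of)
  \<comment> \<open>\<open>f i\<close> is the finite set added at \<open>i\<close>, while
    \<open>stage f i\<close> collects everything chosen up to and including
    \<open>i\<close>.\<close>
  define stage where "stage = (\<lambda>(f :: 'a \<Rightarrow> 'a rel) i. (\<Union>j\<in>underS ?r i. f j) \<union> f i)"
  \<comment> \<open>\<open>E\<close> is the candidate for \<open>f i\<close>; the condition consults
    \<open>f\<close> only below \<open>i\<close>, as well-founded choice requires.\<close>
  define P where "P = (\<lambda>(f :: 'a \<Rightarrow> 'a rel) i E. i \<in> carrier G \<longrightarrow>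
     finite E \<and> partial_starter N ((\<Union>j\<in>underS ?r i. f j) \<union> E) \<and>
     i \<in> Domain ((\<Union>j\<in>underS ?r i. f j) \<union> E) \<and>
     (i \<in> N \<longrightarrow> i \<in> ?\<delta> ` ((\<Union>j\<in>underS ?r i. f j) \<union> E)))"
  have P_stage: "P f i (f i) \<longleftrightarrow> (i \<in> carrier G \<longrightarrow> finite (f i) \<and> partial_starter N (stage f i) \<and>
      i \<in> Domain (stage f i) \<and> (i \<in> N \<longrightarrow> i \<in> ?\<delta> ` stage f i))" for f i
    by (simp add: P_def stage_def)
  have stage_mono: "stage f i \<subseteq> stage f j" if "(i, j) \<in> ?r" for f i j
  proof (cases "i = j")
    case False
    then have "underS ?r i \<subseteq> underS ?r j" "i \<in> underS ?r j"
      using that r.ANTISYM r.TRANS by (auto simp: underS_def dest: transD antisymD)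
    then show ?thesis by (auto simp: stage_def)
  qed simp
  have chain: "chain\<^sub>\<subseteq> (stage f ` I)" if I: "I \<subseteq> carrier G" for f I
  proof -
    have "stage f i \<subseteq> stage f j \<or> stage f j \<subseteq> stage f i" if "i \<in> I" "j \<in> I" for i j
    proof -
      have "(i, j) \<in> ?r \<or> (j, i) \<in> ?r" using that I r.TOTALS Fr by blast
      then show ?thesis using stage_mono by blast
    qed
    then show ?thesis by (auto simp: chain_subset_def)
  qed
  have "\<exists>f. \<forall>i. P f i (f i)"
  proof (rule dependent_wf_choice)
    show "wf (?r - Id)" by (rule r.WF)
  next
    fix f g :: "'a \<Rightarrow> 'a rel" and i E
    assume "\<And>j. (j, i) \<in> ?r - Id \<Longrightarrow> f j = g j"
    then have "(\<Union>j\<in>underS ?r i. f j) = (\<Union>j\<in>underS ?r i. g j)"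
      by (intro SUP_cong) (auto simp: underS_def)
    then show "P f i E = P g i E" by (simp add: P_def)
  next
    fix i and f :: "'a \<Rightarrow> 'a rel"
    assume "\<And>j. (j, i) \<in> ?r - Id \<Longrightarrow> P f j (f j)"
    then have IH: "P f j (f j)" if "j \<in> underS ?r i" for j using that by (auto simp: underS_def)
    show "\<exists>E. P f i E"
    proof (cases "i \<in> carrier G")
      case True
      let ?M = "\<Union>j\<in>underS ?r i. f j"
      have sub: "underS ?r i \<subseteq> carrier G" using Fr by (auto simp: underS_def Field_def)
      \<comment> \<open>A limit index has no last predecessor. Written as the union of a chain of
        stages, the earlier choices form a partial starter at every index.\<close>
      have "?M = \<Union>(stage f ` underS ?r i)"
      proof
        show "?M \<subseteq> \<Union>(stage f ` underS ?r i)" by (auto simp: stage_def)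
        have "k \<in> underS ?r i" if "j \<in> underS ?r i" "k \<in> underS ?r j" for j k
          using that r.ANTISYM r.TRANS by (auto simp: underS_def dest: transD antisymD)
        then show "\<Union>(stage f ` underS ?r i) \<subseteq> ?M" by (auto simp: stage_def)
      qed
      then have "partial_starter N ?M"
        using IH sub chain[OF sub] P_stage by (auto intro!: partial_starter_Union)
      \<comment> \<open>\<open>?r\<close> is a cardinal order, so its proper initial segments are
        smaller than \<open>carrier G\<close>, and each earlier index contributed finitely many
        pairs.\<close>
      moreover have small: "|?M| <o ?r"
      proof (rule card_of_UNION_finite_ordLess[OF inf])
        show "|underS ?r i| <o ?r" using True card_of_underS[OF card_of_Card_order] Fr by metis
        show "finite (f j)" if "j \<in> underS ?r i" for j using IH[OF that] sub that P_stage by blast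
      qed
      ultimately obtain E where "finite E" "partial_starter N (?M \<union> E)" "i \<in> Domain (?M \<union> E)"
        "i \<in> N \<longrightarrow> i \<in> ?\<delta> ` (?M \<union> E)"
        using partial_starter_extend[OF _ N NG inf card_N small True] by metis
      then show ?thesis unfolding P_def by (intro exI[of _ E]) simp
    qed (simp add: P_def)
  qed
  then obtain f where f: "\<And>i. P f i (f i)" by blast
  define M where "M = \<Union>(stage f ` carrier G)"
  have M: "partial_starter N M"
    unfolding M_def using f P_stage chain[of "carrier G" f] by (intro partial_starter_Union) auto
  have dom: "carrier G \<subseteq> Domain M" using f P_stage unfolding M_def by blast
  have diffs: "N \<subseteq> ?\<delta> ` M"
  proof
    fix d assume d: "d \<in> N"
    then have "d \<in> ?\<delta> ` stage f d" using NG f[of d, unfolded P_stage] by blast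
    moreover have "stage f d \<subseteq> M" using d NG unfolding M_def by blast
    ultimately show "d \<in> ?\<delta> ` M" using image_mono by blast
  qed
  \<comment> \<open>\<open>M\<close> is single-valued with full domain, so it is the graph of
    \<open>\<phi>\<close>; its symmetry makes \<open>\<phi>\<close> an involution.\<close>
  define \<phi> where "\<phi> x = (THE y. (x, y) \<in> M)" for x
  have \<phi>: "(x, y) \<in> M \<longleftrightarrow> x \<in> carrier G \<and> y = \<phi> x" for x y
  proof -
    have uniq: "y' = y" if "(x, y) \<in> M" "(x, y') \<in> M" for x y y'
      using that M by (auto simp: partial_starter_def dest: single_valuedD)
    then have "\<phi> x = y" if "(x, y) \<in> M" for x y
      using that unfolding \<phi>_def by (intro the_equality)
    then show ?thesis using dom M by (auto simp: partial_starter_def) 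
  qed
  show ?thesis
  proof (rule that)
    show "\<phi> x \<in> carrier G \<and> \<phi> (\<phi> x) = x" if "x \<in> carrier G" for x
      using that \<phi> M by (metis partial_starter_def symD)
    have graph: "M = (\<lambda>x. (x, \<phi> x)) ` carrier G" using \<phi> by auto
    show "bij_betw (\<lambda>x. x \<otimes> inv \<phi> x) (carrier G) N"
      unfolding bij_betw_def
    proof
      show "inj_on (\<lambda>x. x \<otimes> inv \<phi> x) (carrier G)"
        using M unfolding partial_starter_def graph by (auto simp: inj_on_def)
      show "(\<lambda>x. x \<otimes> inv \<phi> x) ` carrier G = N"
        using M diffs unfolding partial_starter_def graph by auto
    qed
  qed
qed

end

section \<open>Complete equipartite graphs and the stabilizer of a part\<close>

lemma simple_graph_complete_equipartite: "simple_graph (complete_equipartite m n)"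
  by (auto simp: simple_graph_def complete_equipartite_def card_insert_if)

lemma complete_equipartite_edge_iff:
  assumes "x \<in> Field m \<times> Field n" "y \<in> Field m \<times> Field n"
  shows "{x, y} \<in> edges (complete_equipartite m n) \<longleftrightarrow> fst x \<noteq> fst y"
proof
  assume "{x, y} \<in> edges (complete_equipartite m n)"
  then show "fst x \<noteq> fst y" by (auto simp: complete_equipartite_def doubleton_eq_iff)
next
  assume "fst x \<noteq> fst y"
  then show "{x, y} \<in> edges (complete_equipartite m n)"
    using assms unfolding complete_equipartite_def graph.sel by blast
qed

text \<open>Automorphisms are only required to map 1-factors to 1-factors; but every edge lies in
  some 1-factor, whose image is again a 1-factor of the same graph.\<close>

lemma automorphism_preserves_edges:
  assumes \<G>: "one_factorization \<Lambda> \<G>" and \<beta>: "\<beta> \<in> automorphisms \<Lambda> \<G>" and e: "e \<in> edges \<Lambda>"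
  shows "\<beta> ` e \<in> edges \<Lambda>"
proof -
  have "e \<in> \<Union>(edges ` \<G>)"
    using \<G> e by (auto simp: one_factorization_def partition_on_def)
  then obtain \<Gamma> where \<Gamma>: "\<Gamma> \<in> \<G>" "e \<in> edges \<Gamma>" by blast
  then have "image_graph \<beta> \<Gamma> \<in> \<G>" using \<beta> by (simp add: automorphisms_def)
  then have "edges (image_graph \<beta> \<Gamma>) \<subseteq> edges \<Lambda>"
    using \<G> by (auto simp: one_factorization_def one_factor_def spanning_subgraph_def)
  then show ?thesis using \<Gamma> by (auto simp: image_graph_def)
qed

text \<open>The parts are the classes of the non-adjacency relation, so the group permutes them. By
  sharp transitivity, the stabilizer \<open>H\<close> of the part of a vertex \<open>v\<close> is
  equipotent with that part, and its cosets correspond to the parts.\<close>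

lemma (in group) regular_imp_subgroup:
  assumes inf: "infinite (carrier G)" and m: "Card_order m" and n: "Card_order n"
    and reg: "regular_one_factorization G (complete_equipartite m n) \<G>"
  shows "\<exists>H. subgroup H G \<and> |H| =o n \<and> |rcosets H| =o m"
proof -
  let ?K = "complete_equipartite m n" and ?V = "Field m \<times> Field n"
  let ?B = "BijGroup ?V"
  have V: "verts ?K = ?V" by (simp add: complete_equipartite_def)
  obtain A h where fac: "one_factorization ?K \<G>" and A: "subgroup A ?B" "A \<subseteq> automorphisms ?K \<G>"
    and h: "h \<in> iso G (?B\<lparr>carrier := A\<rparr>)" and trans: "sharply_transitive A ?V"
    using reg unfolding regular_one_factorization_def automorphism_group_def V is_iso_def by blast
  have hb: "bij_betw h (carrier G) A" using h by (simp add: iso_def)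
  then have hA: "h g \<in> A" if "g \<in> carrier G" for g using that by (auto simp: bij_betw_def)
  then have hBij: "h g \<in> Bij ?V" if "g \<in> carrier G" for g
    using that A(1) subgroup.subset[OF A(1)] by (auto simp: BijGroup_def)
  then have hV: "h g v \<in> ?V" if "g \<in> carrier G" "v \<in> ?V" for g v
    using that Bij_imp_funcset by blast
  have hmult: "h (g \<otimes> k) v = h g (h k v)" if "g \<in> carrier G" "k \<in> carrier G" "v \<in> ?V" for g k v
  proof -
    have "h (g \<otimes> k) = h g \<otimes>\<^bsub>?B\<^esub> h k" using h that by (simp add: iso_def hom_def)
    also have "\<dots> = compose ?V (h g) (h k)" using hBij that by (simp add: BijGroup_def)
    finally show ?thesis using that(3) by (simp add: compose_def)
  qed
  interpret B: group ?B by (rule group_BijGroup)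
  have hone: "h \<one> v = v" if "v \<in> ?V" for v
  proof -
    have "group (?B\<lparr>carrier := A\<rparr>)" using A(1) B.subgroup_imp_group by blast
    then have "h \<one> = \<one>\<^bsub>?B\<^esub>"
      using h hom_one[of h G "?B\<lparr>carrier := A\<rparr>"] is_group by (simp add: iso_def)
    then show ?thesis using that by (simp add: BijGroup_def)
  qed
  have hpart: "fst (h g x) = fst (h g y) \<longleftrightarrow> fst x = fst y"
    if "g \<in> carrier G" "x \<in> ?V" "y \<in> ?V" for g x y
  proof -
    \<comment> \<open>Preservation of edges shows that distinct parts stay distinct; the converse
      comes from the same fact for \<open>inv g\<close>.\<close>
    have imp: "fst (h g x) \<noteq> fst (h g y)"
      if "g \<in> carrier G" "x \<in> ?V" "y \<in> ?V" "fst x \<noteq> fst y" for g x y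
    proof -
      have "h g ` {x, y} \<in> edges ?K"
        using that hA A(2) complete_equipartite_edge_iff
        by (intro automorphism_preserves_edges[OF fac]) blast+
      then show ?thesis using that hV complete_equipartite_edge_iff by (metis image_empty image_insert)
    qed
    have inv: "h (inv g) (h g v) = v" if "v \<in> ?V" for v
      using that \<open>g \<in> carrier G\<close> hmult[of "inv g" g v] hone by simp
    show ?thesis
      using imp[OF that] imp[of "inv g" "h g x" "h g y"] inv that hV by (metis inv_closed)
  qed
  have reach: "\<exists>!g. g \<in> carrier G \<and> h g x = y" if "x \<in> ?V" "y \<in> ?V" for x y
  proof -
    have "\<exists>!\<beta>. \<beta> \<in> A \<and> \<beta> x = y"
      using trans that unfolding sharply_transitive_def by (elim ballE) auto
    then obtain \<beta> where \<beta>: "\<beta> \<in> A" "\<beta> x = y" and uniq: "\<And>\<gamma>. \<gamma> \<in> A \<Longrightarrow> \<gamma> x = y \<Longrightarrow> \<gamma> = \<beta>"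
      by blast
    obtain g where "g \<in> carrier G" "h g = \<beta>" using \<beta> hb by (auto simp: bij_betw_def)
    moreover have "k = g" if "k \<in> carrier G" "h k x = y" for k
      using that calculation uniq[OF hA] hb by (metis bij_betw_def inj_onD)
    ultimately show ?thesis using \<beta> by blast
  qed
  \<comment> \<open>On an empty vertex set there is only one extensional map, so \<open>A\<close>,
    and with it \<open>G\<close>, would be finite.\<close>
  have "?V \<noteq> {}"
  proof
    assume "?V = {}"
    then have "A \<subseteq> {\<lambda>x. undefined}"
      using subgroup.subset[OF A(1)] by (auto simp: BijGroup_def Bij_def)
    then have "finite A" using finite_subset by blast
    then show False using hb inf bij_betw_finite by blast
  qed
  then obtain v where v: "v \<in> ?V" by blast
  define H where "H = {g \<in> carrier G. fst (h g v) = fst v}"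
  have H: "subgroup H G"
  proof (rule subgroupI)
    show "H \<subseteq> carrier G" by (auto simp: H_def)
    show "H \<noteq> {}" using hone[OF v] one_closed by (auto simp: H_def)
    show "inv g \<in> H" if "g \<in> H" for g
    proof -
      have "fst (h g (h (inv g) v)) = fst (h g v)"
        using that hmult[of g "inv g" v] hone v by (simp add: H_def)
      then show ?thesis using hpart[of g "h (inv g) v" v] that v hV by (simp add: H_def)
    qed
    show "g \<otimes> k \<in> H" if "g \<in> H" "k \<in> H" for g k
      using that hmult v hV hpart[of g "h k v" v] by (simp add: H_def)
  qed
  \<comment> \<open>Acting on \<open>v\<close> maps \<open>H\<close> bijectively onto the part of
    \<open>v\<close>, in which a vertex is determined by its second coordinate.\<close>
  have "bij_betw (\<lambda>g. snd (h g v)) H (Field n)"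
  proof (rule bij_betwI')
    fix g k assume "g \<in> H" "k \<in> H"
    then show "snd (h g v) = snd (h k v) \<longleftrightarrow> g = k"
      using reach[OF v hV[OF _ v]] unfolding H_def by (metis (mono_tags, lifting) mem_Collect_eq prod_eq_iff)
  next
    fix g assume "g \<in> H"
    then show "snd (h g v) \<in> Field n" using hV[of g v] v by (simp add: H_def mem_Times_iff)
  next
    fix j assume "j \<in> Field n"
    then have "(fst v, j) \<in> ?V" using v by auto
    then obtain g where "g \<in> carrier G" "h g v = (fst v, j)" using reach[OF v] by blast
    then show "\<exists>g\<in>H. j = snd (h g v)" by (auto simp: H_def)
  qed
  then have "|H| =o n" using card_of_ordIsoI card_of_Field_ordIso[OF n] ordIso_transitive by blast
  moreover have "|rcosets H| =o m"
  proof -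
    \<comment> \<open>Left cosets \<open>g H\<close> are what correspond to the parts; inversion
      turns the right cosets used here into left ones.\<close>
    have "H #> g = H #> k \<longleftrightarrow> fst (h (inv g) v) = fst (h (inv k) v)"
      if g: "g \<in> carrier G" and k: "k \<in> carrier G" for g k
    proof -
      have "H #> g = H #> k \<longleftrightarrow> g \<otimes> inv k \<in> H"
        using subgroup.rcos_module[OF H is_group k g] repr_independence[OF _ k H] rcos_self[OF g H] by auto
      also have "\<dots> \<longleftrightarrow> fst (h g (h (inv k) v)) = fst (h g (h (inv g) v))"
        using hmult[of g "inv k" v] hmult[of g "inv g" v] hone v g k by (simp add: H_def)
      also have "\<dots> \<longleftrightarrow> fst (h (inv k) v) = fst (h (inv g) v)"
        using g k v hV by (intro hpart) auto
      finally show ?thesis by auto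
    qed
    then have "|(\<lambda>g. H #> g) ` carrier G| =o |(\<lambda>g. fst (h (inv g) v)) ` carrier G|"
      by (rule card_of_image_cong)
    moreover have "(\<lambda>g. H #> g) ` carrier G = rcosets H" by (auto simp: RCOSETS_def)
    moreover have "(\<lambda>g. fst (h (inv g) v)) ` carrier G = Field m"
    proof
      show "(\<lambda>g. fst (h (inv g) v)) ` carrier G \<subseteq> Field m" using hV[OF _ v] by (force simp: mem_Times_iff)
      show "Field m \<subseteq> (\<lambda>g. fst (h (inv g) v)) ` carrier G"
      proof
        fix i assume "i \<in> Field m"
        then have "(i, snd v) \<in> ?V" using v by auto
        then obtain g where g: "g \<in> carrier G" "h g v = (i, snd v)" using reach[OF v] by blast
        then have "i = fst (h (inv (inv g)) v)" by simp
        then show "i \<in> (\<lambda>g. fst (h (inv g) v)) ` carrier G" using g by blast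
      qed
    qed
    ultimately show ?thesis using card_of_Field_ordIso[OF m] ordIso_transitive by metis
  qed
  ultimately show ?thesis using H by blast
qed

section \<open>Regular factorizations from families of involutive maps on the group\<close>

text \<open>Each \<open>\<psi>\<close> in \<open>F\<close> encodes the 1-factor with edges
  \<open>{\<theta> x, \<theta> (\<psi> x)}\<close>. By \<open>cover\<close> and \<open>uniq\<close>
  these factors partition the edges, and by \<open>trans\<close> every right translation maps each
  of them to a factor of the family.\<close>

lemma (in group) regular_one_factorizationI:
  fixes \<theta> :: "'a \<Rightarrow> 'v"
  assumes simple: "simple_graph \<Lambda>" and \<theta>: "bij_betw \<theta> (carrier G) (verts \<Lambda>)"
    and invol: "\<And>\<psi> x. \<psi> \<in> F \<Longrightarrow> x \<in> carrier G \<Longrightarrow> \<psi> x \<in> carrier G \<and> \<psi> (\<psi> x) = x"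
    and edge: "\<And>\<psi> x. \<psi> \<in> F \<Longrightarrow> x \<in> carrier G \<Longrightarrow> {\<theta> x, \<theta> (\<psi> x)} \<in> edges \<Lambda>"
    and cover: "\<And>e. e \<in> edges \<Lambda> \<Longrightarrow> \<exists>\<psi>\<in>F. \<exists>x\<in>carrier G. e = {\<theta> x, \<theta> (\<psi> x)}"
    and uniq: "\<And>\<psi> \<chi> x. \<psi> \<in> F \<Longrightarrow> \<chi> \<in> F \<Longrightarrow> x \<in> carrier G \<Longrightarrow> \<psi> x = \<chi> x \<Longrightarrow> \<psi> = \<chi>"
    and trans: "\<And>\<psi> g. \<psi> \<in> F \<Longrightarrow> g \<in> carrier G \<Longrightarrow> \<exists>\<chi>\<in>F. \<forall>x\<in>carrier G. \<chi> (x \<otimes> g) = \<psi> x \<otimes> g"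
  shows "\<exists>\<G>. regular_one_factorization G \<Lambda> \<G>"
proof -
  let ?V = "verts \<Lambda>" and ?B = "BijGroup (verts \<Lambda>)"
  define E where "E \<psi> = (\<lambda>x. {\<theta> x, \<theta> (\<psi> x)}) ` carrier G" for \<psi>
  define \<G> where "\<G> = (\<lambda>\<psi>. Graph ?V (E \<psi>)) ` F"
  have inj: "\<theta> x = \<theta> y \<longleftrightarrow> x = y" if "x \<in> carrier G" "y \<in> carrier G" for x y
    using that \<theta> by (auto simp: bij_betw_def inj_on_def)
  have V: "?V = \<theta> ` carrier G" using \<theta> by (simp add: bij_betw_def)
  have E_sub: "E \<psi> \<subseteq> edges \<Lambda>" if "\<psi> \<in> F" for \<psi> using edge that by (auto simp: E_def)
  \<comment> \<open>As \<open>\<psi>\<close> is an involution, an edge of its factor can be read off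
    from either end. This gives both degree one and disjointness.\<close>
  have at: "e = {\<theta> x, \<theta> (\<psi> x)}" if "\<psi> \<in> F" and e: "e \<in> E \<psi>" and "x \<in> carrier G" "\<theta> x \<in> e" for \<psi> e x
  proof -
    obtain y where y: "y \<in> carrier G" "e = {\<theta> y, \<theta> (\<psi> y)}" using e unfolding E_def by blast
    then have "x = y \<or> x = \<psi> y" using that inj invol by auto
    then show ?thesis using y invol[OF that(1) y(1)] by auto
  qed
  have factor: "one_factor \<Lambda> (Graph ?V (E \<psi>))" if \<psi>: "\<psi> \<in> F" for \<psi>
  proof -
    have "card {e \<in> E \<psi>. v \<in> e} = 1" if v: "v \<in> ?V" for v
    proof -
      obtain x where x: "x \<in> carrier G" "v = \<theta> x" using v V by blast
      have "{e \<in> E \<psi>. v \<in> e} = {{\<theta> x, \<theta> (\<psi> x)}}"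
      proof
        show "{e \<in> E \<psi>. v \<in> e} \<subseteq> {{\<theta> x, \<theta> (\<psi> x)}}" using at[OF \<psi> _ x(1)] x(2) by blast
        show "{{\<theta> x, \<theta> (\<psi> x)}} \<subseteq> {e \<in> E \<psi>. v \<in> e}" using x unfolding E_def by blast
      qed
      then show ?thesis by simp
    qed
    then show ?thesis
      using simple E_sub[OF \<psi>]
      by (auto simp: one_factor_def spanning_subgraph_def simple_graph_def degree_def)
  qed
  have edges_\<G>: "edges ` \<G> = E ` F" by (simp add: \<G>_def image_image)
  have "partition_on (edges \<Lambda>) (edges ` \<G>)"
    unfolding partition_on_def edges_\<G>
  proof (intro conjI)
    show "\<Union>(E ` F) = edges \<Lambda>"
    proof
      show "\<Union>(E ` F) \<subseteq> edges \<Lambda>" using E_sub by blast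
      show "edges \<Lambda> \<subseteq> \<Union>(E ` F)" using cover unfolding E_def by blast
    qed
    show "disjoint (E ` F)"
    proof (rule disjointI)
      fix a b assume ab: "a \<in> E ` F" "b \<in> E ` F" "a \<noteq> b"
      then obtain \<psi> \<chi> where *: "\<psi> \<in> F" "\<chi> \<in> F" "a = E \<psi>" "b = E \<chi>" by blast
      show "a \<inter> b = {}"
      proof (rule ccontr)
        assume "a \<inter> b \<noteq> {}"
        then obtain e where e: "e \<in> E \<psi>" "e \<in> E \<chi>" using * by blast
        then obtain x where x: "x \<in> carrier G" "e = {\<theta> x, \<theta> (\<psi> x)}" unfolding E_def by blast
        then have "e = {\<theta> x, \<theta> (\<chi> x)}" using at[OF *(2) e(2)] by blast
        then have "\<theta> (\<psi> x) = \<theta> (\<chi> x)" using x by (auto simp: doubleton_eq_iff)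
        then have "\<psi> = \<chi>" using uniq * x(1) inj invol by blast
        then show False using ab * by simp
      qed
    qed
    show "{} \<notin> E ` F" using one_closed by (auto simp: E_def)
  qed
  then have fac: "one_factorization \<Lambda> \<G>"
    using factor by (auto simp: one_factorization_def \<G>_def)
  \<comment> \<open>Multiplying by \<open>inv g\<close> rather than \<open>g\<close> makes
    \<open>\<rho>\<close> a homomorphism into the maps under composition; the restriction to
    \<open>?V\<close> makes \<open>\<rho> g\<close> extensional, as \<open>Bij\<close>
    demands.\<close>
  define \<rho> where "\<rho> g = (\<lambda>v\<in>?V. \<theta> (inv_into (carrier G) \<theta> v \<otimes> inv g))" for g
  have \<rho>: "\<rho> g (\<theta> x) = \<theta> (x \<otimes> inv g)" if "x \<in> carrier G" for g x
    using that V \<theta> by (simp add: \<rho>_def bij_betw_inv_into_left)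
  have \<rho>_Bij: "\<rho> g \<in> Bij ?V" if g: "g \<in> carrier G" for g
  proof -
    have "bij_betw (\<rho> g) ?V ?V"
      unfolding bij_betw_def
    proof
      show "inj_on (\<rho> g) ?V" unfolding V using g inj by (auto simp: inj_on_def \<rho>)
      show "\<rho> g ` ?V = ?V"
      proof
        show "\<rho> g ` ?V \<subseteq> ?V" unfolding V using g by (auto simp: \<rho>)
        show "?V \<subseteq> \<rho> g ` ?V"
        proof
          fix v assume "v \<in> ?V"
          then obtain x where x: "x \<in> carrier G" "v = \<theta> x" using V by blast
          then have "v = \<rho> g (\<theta> (x \<otimes> g))" using g by (simp add: \<rho> m_assoc)
          then show "v \<in> \<rho> g ` ?V" using x g V by blast
        qed
      qed
    qed
    then show ?thesis by (simp add: Bij_def \<rho>_def)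
  qed
  have \<rho>_hom: "\<rho> \<in> hom G ?B"
  proof (rule homI)
    fix g k assume gk: "g \<in> carrier G" "k \<in> carrier G"
    have "\<rho> (g \<otimes> k) = compose ?V (\<rho> g) (\<rho> k)"
    proof (rule extensionalityI[where A = ?V])
      fix v assume "v \<in> ?V"
      then obtain x where "x \<in> carrier G" "v = \<theta> x" using V by blast
      then show "\<rho> (g \<otimes> k) v = compose ?V (\<rho> g) (\<rho> k) v"
        using gk V by (simp add: compose_def \<rho> inv_mult_group m_assoc)
    qed (auto simp: \<rho>_def compose_def)
    then show "\<rho> (g \<otimes> k) = \<rho> g \<otimes>\<^bsub>?B\<^esub> \<rho> k" using gk \<rho>_Bij by (simp add: BijGroup_def)
  qed (simp add: BijGroup_def \<rho>_Bij)
  interpret \<rho>: group_hom G ?B \<rho>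
    using \<rho>_hom by (simp add: group_hom_def group_hom_axioms_def group_BijGroup)
  \<comment> \<open>Solving for \<open>g\<close> yields both the injectivity of
    \<open>\<rho>\<close> and sharp transitivity.\<close>
  have reach: "\<rho> g (\<theta> x) = \<theta> y \<longleftrightarrow> g = inv y \<otimes> x"
    if "g \<in> carrier G" "x \<in> carrier G" "y \<in> carrier G" for g x y
    using that \<rho> inj by (metis inv_solve_left inv_solve_right m_closed inv_closed)
  let ?A = "\<rho> ` carrier G"
  have "inj_on \<rho> (carrier G)"
    using reach[of _ \<one>] one_closed \<rho> by (intro inj_onI) (metis m_closed inv_closed)
  then have iso: "G \<cong> ?B\<lparr>carrier := ?A\<rparr>"
    using \<rho>_hom by (intro is_isoI[of \<rho>]) (auto simp: iso_def hom_def bij_betw_def)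
  have "?A \<subseteq> automorphisms \<Lambda> \<G>"
  proof -
    have "image_graph (\<rho> g) (Graph ?V (E \<psi>)) \<in> \<G>" if g: "g \<in> carrier G" and \<psi>: "\<psi> \<in> F" for g \<psi>
    proof -
      obtain \<chi> where \<chi>: "\<chi> \<in> F" "\<And>x. x \<in> carrier G \<Longrightarrow> \<chi> (x \<otimes> inv g) = \<psi> x \<otimes> inv g"
        using trans[OF \<psi> inv_closed[OF g]] by blast
      have img: "\<rho> g ` {\<theta> x, \<theta> (\<psi> x)} = {\<theta> (x \<otimes> inv g), \<theta> (\<chi> (x \<otimes> inv g))}" if "x \<in> carrier G" for x
        using that \<chi>(2) invol[OF \<psi>] by (simp add: \<rho>)
      have "(\<lambda>e. \<rho> g ` e) ` E \<psi> = E \<chi>"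
      proof
        show "(\<lambda>e. \<rho> g ` e) ` E \<psi> \<subseteq> E \<chi>" 
          using img g unfolding E_def image_image by (intro image_subsetI) simp
        show "E \<chi> \<subseteq> (\<lambda>e. \<rho> g ` e) ` E \<psi>"
        proof
          fix e assume "e \<in> E \<chi>"
          then obtain x where x: "x \<in> carrier G" "e = {\<theta> x, \<theta> (\<chi> x)}" unfolding E_def by blast
          then have "e = \<rho> g ` {\<theta> (x \<otimes> g), \<theta> (\<psi> (x \<otimes> g))}"
            using img[of "x \<otimes> g"] g by (simp add: m_assoc)
          then show "e \<in> (\<lambda>e. \<rho> g ` e) ` E \<psi>" using x g unfolding E_def by blast
        qed
      qed
      moreover have "\<rho> g ` ?V = ?V" using \<rho>_Bij[OF g] by (simp add: Bij_def bij_betw_def)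
      ultimately show ?thesis using \<chi>(1) by (simp add: image_graph_def \<G>_def)
    qed
    then show ?thesis using \<rho>_Bij by (auto simp: automorphisms_def \<G>_def)
  qed
  then have "automorphism_group \<Lambda> \<G> ?A"
    using \<rho>.img_is_subgroup by (simp add: automorphism_group_def)
  moreover have "sharply_transitive ?A ?V"
    unfolding sharply_transitive_def
  proof (intro ballI)
    fix u v assume "u \<in> ?V" "v \<in> ?V"
    then have "u \<in> \<theta> ` carrier G" "v \<in> \<theta> ` carrier G" using V by simp_all
    then obtain x y where xy: "x \<in> carrier G" "y \<in> carrier G" "u = \<theta> x" "v = \<theta> y"
      by (elim imageE) blast
    show "\<exists>!\<beta>. \<beta> \<in> ?A \<and> \<beta> u = v"
    proof (rule ex1I[of _ "\<rho> (inv y \<otimes> x)"])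
      have "inv y \<otimes> x \<in> carrier G" using xy by simp
      then show "\<rho> (inv y \<otimes> x) \<in> ?A \<and> \<rho> (inv y \<otimes> x) u = v"
        using xy reach[of "inv y \<otimes> x" x y] by blast
      show "\<beta> = \<rho> (inv y \<otimes> x)" if "\<beta> \<in> ?A \<and> \<beta> u = v" for \<beta>
        using that xy reach by blast
    qed
  qed
  ultimately show ?thesis using fac iso unfolding regular_one_factorization_def by blast
qed

section \<open>Group elements as vertices, and the factorization from a subgroup\<close>

text \<open>Every \<open>x\<close> is uniquely \<open>h \<otimes> r\<close> with \<open>h\<close> in
  \<open>H\<close> and \<open>r\<close> the chosen representative of its right coset. Numbering the
  coset by \<open>Field m\<close> and \<open>h\<close> by \<open>Field n\<close> turns the parts
  into the right cosets of \<open>H\<close>.\<close>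

lemma (in group) exists_coset_coordinates:
  assumes H: "subgroup H G" and n: "Card_order n" "|H| =o n" and m: "Card_order m" "|rcosets H| =o m"
  obtains \<theta> where "bij_betw \<theta> (carrier G) (Field m \<times> Field n)"
    "\<And>x y. x \<in> carrier G \<Longrightarrow> y \<in> carrier G \<Longrightarrow> fst (\<theta> x) = fst (\<theta> y) \<longleftrightarrow> x \<otimes> inv y \<in> H"
proof -
  have "|rcosets H| =o |Field m|" "|H| =o |Field n|"
    using m n card_of_Field_ordIso ordIso_symmetric ordIso_transitive by blast+
  then obtain a b where a: "bij_betw a (rcosets H) (Field m)" and b: "bij_betw b H (Field n)"
    using card_of_ordIso by metis
  define rep where "rep K = (SOME x. x \<in> K)" for K :: "'a set"
  note HG = subgroup.mem_carrier[OF H]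
  have coset_eq: "H #> x = H #> y \<longleftrightarrow> x \<otimes> inv y \<in> H" if "x \<in> carrier G" "y \<in> carrier G" for x y
    using that subgroup.rcos_module[OF H is_group that(2,1)] repr_independence[OF _ that(2) H]
      rcos_self[OF that(1) H] by auto
  have rep: "rep (H #> x) \<in> carrier G" "H #> rep (H #> x) = H #> x" if "x \<in> carrier G" for x
  proof -
    have "rep (H #> x) \<in> H #> x" unfolding rep_def using rcos_self[OF that H] by (rule someI)
    then show "rep (H #> x) \<in> carrier G" "H #> rep (H #> x) = H #> x"
      using repr_independence[OF _ that H] subgroup.elemrcos_carrier[OF H is_group that] by auto
  qed
  have rc: "H #> x \<in> rcosets H" if "x \<in> carrier G" for x
    using that by (auto simp: RCOSETS_def)
  define \<theta> where "\<theta> x = (a (H #> x), b (x \<otimes> inv (rep (H #> x))))" for x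
  have in_H: "x \<otimes> inv (rep (H #> x)) \<in> H" if "x \<in> carrier G" for x
    using that rep coset_eq by metis
  have fst_\<theta>: "fst (\<theta> x) = fst (\<theta> y) \<longleftrightarrow> H #> x = H #> y" if "x \<in> carrier G" "y \<in> carrier G" for x y
    using that a rc by (auto simp: \<theta>_def bij_betw_def dest: inj_onD)
  have "bij_betw \<theta> (carrier G) (Field m \<times> Field n)"
    unfolding bij_betw_def
  proof
    show "inj_on \<theta> (carrier G)"
    proof (rule inj_onI)
      fix x y assume xy: "x \<in> carrier G" "y \<in> carrier G" "\<theta> x = \<theta> y"
      then have eq: "H #> x = H #> y" using fst_\<theta> by metis
      then have "x \<otimes> inv (rep (H #> x)) = y \<otimes> inv (rep (H #> x))"
        using xy in_H b unfolding \<theta>_def bij_betw_def by (metis inj_onD prod.inject)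
      then show "x = y" using xy rep by (metis inv_closed right_cancel)
    qed
    show "\<theta> ` carrier G = Field m \<times> Field n"
    proof
      show "\<theta> ` carrier G \<subseteq> Field m \<times> Field n"
        using a b rc in_H by (auto simp: \<theta>_def bij_betw_def)
      show "Field m \<times> Field n \<subseteq> \<theta> ` carrier G"
      proof
        fix p assume p: "p \<in> Field m \<times> Field n"
        have "a ` (rcosets H) = Field m" "b ` H = Field n" using a b by (simp_all add: bij_betw_def)
        then have "fst p \<in> a ` (rcosets H)" "snd p \<in> b ` H" using p by auto
        then obtain K h where K: "K \<in> rcosets H" "h \<in> H" "p = (a K, b h)"
          by (metis imageE prod.collapse)
        then obtain x where x: "x \<in> carrier G" "K = H #> x" by (auto simp: RCOSETS_def)
        \<comment> \<open>The preimage lies in the coset \<open>K\<close>, so it has the same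
          representative as \<open>K\<close>.\<close>
        let ?y = "h \<otimes> rep K"
        have yG: "?y \<in> carrier G" using x rep K HG by simp
        have "?y \<otimes> inv (rep K) = h" using x rep[OF x(1)] K HG by (simp add: m_assoc)
        moreover from this have "H #> ?y = K"
          using coset_eq[OF yG rep(1)[OF x(1)]] rep(2)[OF x(1)] K x by simp
        ultimately have "\<theta> ?y = p" using K by (simp add: \<theta>_def)
        then show "p \<in> \<theta> ` carrier G" using yG by blast
      qed
    qed
  qed
  then show ?thesis
    by (rule that) (simp add: fst_\<theta> coset_eq)
qed

text \<open>The difference of an edge decides which 1-factor contains it: an involution
  \<open>d\<close> gives left multiplication by \<open>d\<close>, and a difference in
  \<open>N\<close> occurs once in the starter, hence the edge lies in exactly one translate.\<close>

lemma (in group) subgroup_imp_regular: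
  assumes inf: "infinite (carrier G)" and m: "Card_order m" and n: "Card_order n"
    and H: "subgroup H G" "|H| =o n" "|rcosets H| =o m"
  shows "\<exists>\<G>. regular_one_factorization G (complete_equipartite m n) \<G>"
proof -
  let ?K = "complete_equipartite m n"
  have V: "verts ?K = Field m \<times> Field n" by (simp add: complete_equipartite_def)
  obtain \<theta> where \<theta>: "bij_betw \<theta> (carrier G) (Field m \<times> Field n)"
    and fst_\<theta>: "\<And>x y. x \<in> carrier G \<Longrightarrow> y \<in> carrier G \<Longrightarrow> fst (\<theta> x) = fst (\<theta> y) \<longleftrightarrow> x \<otimes> inv y \<in> H"
    using exists_coset_coordinates[OF H(1) n H(2) m H(3)] by blast
  have \<theta>_V: "\<theta> x \<in> Field m \<times> Field n" if "x \<in> carrier G" for x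
    using bij_betwE[OF \<theta>] that by blast
  have edge_iff: "{\<theta> x, \<theta> y} \<in> edges ?K \<longleftrightarrow> x \<otimes> inv y \<notin> H"
    if "x \<in> carrier G" "y \<in> carrier G" for x y
    using that complete_equipartite_edge_iff[OF \<theta>_V \<theta>_V] fst_\<theta> by simp
  define N where "N = {d \<in> carrier G - H. d \<otimes> d \<noteq> \<one>}"
  have N_inv: "inv d \<in> N \<and> inv d \<noteq> d" if "d \<in> N" for d
  proof -
    have d: "d \<in> carrier G" "d \<notin> H" "d \<otimes> d \<noteq> \<one>" using that by (auto simp: N_def)
    then have "inv d \<notin> H" using subgroup.m_inv_closed[OF H(1), of "inv d"] by auto
    moreover have "inv d \<otimes> inv d \<noteq> \<one>" using d by (metis inv_closed inv_eq_1_iff inv_mult_group m_closed)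
    moreover have "inv d \<noteq> d" using d by (metis r_inv)
    ultimately show ?thesis using d by (simp add: N_def)
  qed
  \<comment> \<open>The implication lets \<open>\<phi>\<close> be named before the cases for
    \<open>N\<close> are separated; for empty \<open>N\<close> it carries no information.\<close>
  have "\<exists>\<phi>. N \<noteq> {} \<longrightarrow> (\<forall>x\<in>carrier G. \<phi> x \<in> carrier G \<and> \<phi> (\<phi> x) = x) \<and>
      bij_betw (\<lambda>x. x \<otimes> inv \<phi> x) (carrier G) N"
  proof (cases "N = {}")
    case False
    then have card: "|N| =o |carrier G|"
      using noninvolutions_outside_subgroup[OF H(1) inf N_def] by blast
    obtain \<phi> where "\<And>x. x \<in> carrier G \<Longrightarrow> \<phi> x \<in> carrier G \<and> \<phi> (\<phi> x) = x"
      "bij_betw (\<lambda>x. x \<otimes> inv \<phi> x) (carrier G) N"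
      using exists_starter[OF N_inv _ inf card] unfolding N_def by blast
    then show ?thesis by blast
  qed simp
  then obtain \<phi> where \<phi>: "\<And>x. N \<noteq> {} \<Longrightarrow> x \<in> carrier G \<Longrightarrow> \<phi> x \<in> carrier G \<and> \<phi> (\<phi> x) = x"
    "N \<noteq> {} \<Longrightarrow> bij_betw (\<lambda>x. x \<otimes> inv \<phi> x) (carrier G) N" by blast
  \<comment> \<open>Left multiplications commute with right translations, so the factors in
    \<open>fixed\<close> are invariant, whereas \<open>moved\<close> consists of the translates of
    one starter. For empty \<open>N\<close> the map \<open>\<phi>\<close> is arbitrary, so
    \<open>moved\<close> is then made empty.\<close>
  define fixed where "fixed = (\<lambda>d x. d \<otimes> x) ` {d \<in> carrier G - H. d \<otimes> d = \<one>}"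
  define moved where "moved = (if N = {} then {} else (\<lambda>g x. \<phi> (x \<otimes> inv g) \<otimes> g) ` carrier G)"
  have fixedE: "\<exists>d. d \<in> carrier G \<and> d \<notin> H \<and> d \<otimes> d = \<one> \<and> inv d = d \<and> \<psi> = (\<lambda>x. d \<otimes> x)"
    if "\<psi> \<in> fixed" for \<psi>
    using that inv_equality by (auto simp: fixed_def)
  have movedE: "\<exists>g. N \<noteq> {} \<and> g \<in> carrier G \<and> \<psi> = (\<lambda>x. \<phi> (x \<otimes> inv g) \<otimes> g)" if "\<psi> \<in> moved" for \<psi>
    using that by (auto simp: moved_def split: if_splits)
  have fixed_diff: "x \<otimes> inv (d \<otimes> x) = inv d" if "d \<in> carrier G" "x \<in> carrier G" for d x
    using that by (simp add: inv_mult_group m_assoc[symmetric])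
  have moved_diff: "x \<otimes> inv (\<phi> (x \<otimes> inv g) \<otimes> g) = (x \<otimes> inv g) \<otimes> inv \<phi> (x \<otimes> inv g)"
    if "N \<noteq> {}" "g \<in> carrier G" "x \<in> carrier G" for g x
    using that \<phi>(1) by (simp add: inv_mult_group m_assoc)
  have moved_N: "(x \<otimes> inv g) \<otimes> inv \<phi> (x \<otimes> inv g) \<in> N"
    if "N \<noteq> {}" "g \<in> carrier G" "x \<in> carrier G" for g x
    using that bij_betwE[OF \<phi>(2)] by simp
  have closed: "\<psi> x \<in> carrier G \<and> \<psi> (\<psi> x) = x" if \<psi>: "\<psi> \<in> fixed \<union> moved" and x: "x \<in> carrier G" for \<psi> x
    using \<psi>
  proof
    assume "\<psi> \<in> fixed"
    then show ?thesis using fixedE[of \<psi>] x by (auto simp: m_assoc[symmetric])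
  next
    assume "\<psi> \<in> moved"
    then obtain g where "N \<noteq> {}" "g \<in> carrier G" "\<psi> = (\<lambda>x. \<phi> (x \<otimes> inv g) \<otimes> g)" using movedE by blast
    then show ?thesis using x \<phi>(1) by (simp add: m_assoc)
  qed
  show ?thesis
  proof (rule regular_one_factorizationI[where F = "fixed \<union> moved" and \<theta> = \<theta>])
    show "simple_graph ?K" by (rule simple_graph_complete_equipartite)
    show "bij_betw \<theta> (carrier G) (verts ?K)" using \<theta> V by simp
    show "\<psi> x \<in> carrier G \<and> \<psi> (\<psi> x) = x" if "\<psi> \<in> fixed \<union> moved" "x \<in> carrier G" for \<psi> x
      using closed that by blast
  next
    fix \<psi> x assume \<psi>: "\<psi> \<in> fixed \<union> moved" and x: "x \<in> carrier G"
    have "x \<otimes> inv \<psi> x \<notin> H"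
      using \<psi>
    proof
      assume "\<psi> \<in> fixed"
      then show ?thesis using fixedE[of \<psi>] fixed_diff x by auto
    next
      assume "\<psi> \<in> moved"
      then obtain g where g: "N \<noteq> {}" "g \<in> carrier G" "\<psi> = (\<lambda>x. \<phi> (x \<otimes> inv g) \<otimes> g)" using movedE by blast
      then have "x \<otimes> inv \<psi> x \<in> N" using moved_N[OF g(1,2) x] moved_diff[OF g(1,2) x] by simp
      then show ?thesis by (simp add: N_def)
    qed
    then show "{\<theta> x, \<theta> (\<psi> x)} \<in> edges ?K" using edge_iff x closed[OF \<psi> x] by simp
  next
    fix e assume e: "e \<in> edges ?K"
    then obtain u v where uv: "u \<in> Field m \<times> Field n" "v \<in> Field m \<times> Field n" "e = {u, v}"
      by (auto simp: complete_equipartite_def)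
    then obtain x y where xy: "x \<in> carrier G" "y \<in> carrier G" "e = {\<theta> x, \<theta> y}"
      using \<theta> unfolding bij_betw_def by (metis imageE)
    define d where "d = x \<otimes> inv y"
    have d: "d \<in> carrier G" "d \<notin> H" using xy e edge_iff by (auto simp: d_def)
    have y: "y = inv d \<otimes> x" using xy by (simp add: d_def inv_mult_group m_assoc)
    have "\<exists>\<psi>\<in>fixed \<union> moved. \<psi> x = y"
    proof (cases "d \<otimes> d = \<one>")
      case True
      then have "inv d = d" using d inv_equality by blast
      then have "(\<lambda>x. d \<otimes> x) \<in> fixed" "d \<otimes> x = y" using True d y by (auto simp: fixed_def)
      then show ?thesis by blast
    next
      case False
      then have "d \<in> N" using d by (simp add: N_def)
      then have ne: "N \<noteq> {}" by blast
      then obtain u where u: "u \<in> carrier G" "d = u \<otimes> inv \<phi> u"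
        using \<open>d \<in> N\<close> \<phi>(2) unfolding bij_betw_def by blast
      \<comment> \<open>Right translation by \<open>g\<close> carries \<open>u\<close>, where the
        starter has difference \<open>d\<close>, to \<open>x\<close>, and hence
        \<open>\<phi> u\<close> to \<open>y\<close>.\<close>
      define g where "g = inv u \<otimes> x"
      have g: "g \<in> carrier G" using u xy by (simp add: g_def)
      have "x \<otimes> inv g = u" using u xy by (simp add: g_def inv_mult_group m_assoc[symmetric])
      then have "\<phi> (x \<otimes> inv g) \<otimes> g = y"
        using u xy \<phi>(1)[OF ne u(1)] y by (simp add: g_def inv_mult_group m_assoc)
      moreover have "(\<lambda>x. \<phi> (x \<otimes> inv g) \<otimes> g) \<in> moved" using ne g by (auto simp: moved_def)
      ultimately show ?thesis by (intro bexI[of _ "\<lambda>x. \<phi> (x \<otimes> inv g) \<otimes> g"]) simp_all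
    qed
    then obtain \<psi> where "\<psi> \<in> fixed \<union> moved" "\<psi> x = y" by (elim bexE)
    then show "\<exists>\<psi>\<in>fixed \<union> moved. \<exists>x\<in>carrier G. e = {\<theta> x, \<theta> (\<psi> x)}"
      using xy by (intro bexI[of _ \<psi>] bexI[of _ x]) simp_all
  next
    fix \<psi> \<chi> x assume \<psi>: "\<psi> \<in> fixed \<union> moved" and \<chi>: "\<chi> \<in> fixed \<union> moved"
      and x: "x \<in> carrier G" and eq: "\<psi> x = \<chi> x"
    \<comment> \<open>At \<open>x\<close>, a factor in \<open>fixed\<close> has a difference
      squaring to \<open>\<one>\<close>, while one in \<open>moved\<close> has a difference in
      \<open>N\<close>.\<close>
    have dichotomy: False if f: "\<psi> \<in> fixed" and m: "\<chi> \<in> moved" and eq: "\<psi> x = \<chi> x" for \<psi> \<chi>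
    proof -
      obtain d where d: "d \<in> carrier G" "d \<otimes> d = \<one>" "inv d = d" "\<psi> = (\<lambda>x. d \<otimes> x)"
        using fixedE[OF f] by blast
      obtain g where g: "N \<noteq> {}" "g \<in> carrier G" "\<chi> = (\<lambda>x. \<phi> (x \<otimes> inv g) \<otimes> g)"
        using movedE[OF m] by blast
      have "d \<in> N" using moved_diff[OF g(1,2) x] moved_N[OF g(1,2) x] fixed_diff[OF d(1) x] eq d g by simp
      then show False using d by (simp add: N_def)
    qed
    consider "\<psi> \<in> fixed" "\<chi> \<in> fixed" | "\<psi> \<in> moved" "\<chi> \<in> moved"
      using \<psi> \<chi> eq dichotomy[of \<psi> \<chi>] dichotomy[of \<chi> \<psi>] by auto
    then show "\<psi> = \<chi>"
    proof cases
      case 1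
      then show ?thesis using fixedE[of \<psi>] fixedE[of \<chi>] eq x by auto
    next
      case 2
      then obtain g h where g: "N \<noteq> {}" "g \<in> carrier G" "\<psi> = (\<lambda>x. \<phi> (x \<otimes> inv g) \<otimes> g)"
        and h: "h \<in> carrier G" "\<chi> = (\<lambda>x. \<phi> (x \<otimes> inv h) \<otimes> h)" using movedE by meson
      \<comment> \<open>Both translates have the same difference at \<open>x\<close>; the starter
        realizes it only once, so \<open>x\<close> comes from the same starter vertex in
        both.\<close>
      have "(x \<otimes> inv g) \<otimes> inv \<phi> (x \<otimes> inv g) = (x \<otimes> inv h) \<otimes> inv \<phi> (x \<otimes> inv h)"
        using moved_diff[OF g(1,2) x] moved_diff[OF g(1) h(1) x] eq g h by simp
      then have "x \<otimes> inv g = x \<otimes> inv h"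
        using \<phi>(2)[OF g(1)] g(2) h(1) x unfolding bij_betw_def inj_on_def by simp
      then have "inv g = inv h"
        using g(2) h(1) x Units_l_cancel[of x "inv g" "inv h"] Units_eq by simp
      then have "g = h" using g(2) h(1) inv_inv by metis
      then show ?thesis using g h by simp
    qed
  next
    fix \<psi> h assume \<psi>: "\<psi> \<in> fixed \<union> moved" and h: "h \<in> carrier G"
    show "\<exists>\<chi>\<in>fixed \<union> moved. \<forall>x\<in>carrier G. \<chi> (x \<otimes> h) = \<psi> x \<otimes> h"
      using \<psi>
    proof
      assume "\<psi> \<in> fixed"
      then obtain d where "d \<in> carrier G" "\<psi> = (\<lambda>x. d \<otimes> x)" using fixedE by blast
      then show ?thesis using h \<psi> by (intro bexI[of _ \<psi>]) (simp_all add: m_assoc)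
    next
      assume "\<psi> \<in> moved"
      then obtain g where g: "N \<noteq> {}" "g \<in> carrier G" "\<psi> = (\<lambda>x. \<phi> (x \<otimes> inv g) \<otimes> g)" using movedE by blast
      \<comment> \<open>Translating by \<open>h\<close> the translate of the starter by
        \<open>g\<close> gives its translate by \<open>g \<otimes> h\<close>.\<close>
      have "(x \<otimes> h) \<otimes> inv (g \<otimes> h) = x \<otimes> inv g" if "x \<in> carrier G" for x
        using that g(2) h by (metis inv_closed inv_mult_group inv_solve_right m_assoc m_closed)
      then have "\<phi> ((x \<otimes> h) \<otimes> inv (g \<otimes> h)) \<otimes> (g \<otimes> h) = \<psi> x \<otimes> h" if "x \<in> carrier G" for x
        using that g h \<phi>(1)[OF g(1)] by (simp add: m_assoc)
      moreover have "(\<lambda>x. \<phi> (x \<otimes> inv (g \<otimes> h)) \<otimes> (g \<otimes> h)) \<in> moved"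
        using g h by (auto simp: moved_def)
      ultimately show ?thesis by (intro bexI[of _ "\<lambda>x. \<phi> (x \<otimes> inv (g \<otimes> h)) \<otimes> (g \<otimes> h)"]) simp_all
    qed
  qed
qed

theorem theorem1p1:
  fixes G :: "('a, 'b) monoid_scheme" and m :: "'m rel" and n :: "'n rel"
  assumes "group G" and "infinite (carrier G)"
    and "Card_order m" and "Card_order n"
  shows "(\<exists>\<G>. regular_one_factorization G (complete_equipartite m n) \<G>) \<longleftrightarrow>
         (\<exists>H. subgroup H G \<and> |H| =o n \<and> |(rcosets\<^bsub>G\<^esub> H)| =o m)"
  using group.regular_imp_subgroup[OF assms] group.subgroup_imp_regular[OF assms] by blast

end
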